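(* Let $d\ge2$ be an integer and $r,\varepsilon>0$ with $\lambda(\varepsilon,r):=\log(re^r/\varepsilon)>0$. Let $$f_d(N,m):=m\frac{d^{N+1}}{(d-1)N},\qquad m^*(N):=\bigg(\frac{e^r r^{N+1}}{\varepsilon\,(N+1)!}\bigg)^{1/N},\qquad N,m\in(0,\infty),$$ and $$\widetilde N:=\sqrt{\frac{\lambda(\varepsilon,r)}{\log d}},\qquad \widetilde m:=m^*(\widetilde N),\qquad m^\circ:=\frac{r^2e^r}{2\varepsilon}.$$ Then $$f_d(\widetilde N,\widetilde m)\le \frac{r\,d\log d}{(d-1)\lambda(\varepsilon,r)}\exp\Big(1+2\sqrt{\lambda(\varepsilon,r)\log d}\Big),$$ and the right-hand side is $\mathrm o\big(f_d(1,m^\circ)\big)$ both as $r\to+\infty$ with $\varepsilon$ fixed and as $\varepsilon\to0^+$ with $r$ fixed.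
   Context: $(N+1)!:=\Gamma(N+2)$ for real $N>0$. *)

theory Defs
  imports "HOL-Analysis.Analysis" "HOL-Library.Landau_Symbols"
begin

text \<open>The factorial \<open>(N + 1)!\<close> of a real \<open>N > 0\<close>, read as \<open>\<Gamma>(N + 2)\<close>.\<close>

definition fact_Suc_real :: "real \<Rightarrow> real" where
  "fact_Suc_real N = Gamma (N + 2)"

definition lam :: "real \<Rightarrow> real \<Rightarrow> real" where
  "lam \<epsilon> r = ln (r * exp r / \<epsilon>)"

definition f_d :: "nat \<Rightarrow> real \<Rightarrow> real \<Rightarrow> real" where
  "f_d d N m = m * (real d powr (N + 1) / ((real d - 1) * N))"

definition m_star :: "real \<Rightarrow> real \<Rightarrow> real \<Rightarrow> real" where
  "m_star \<epsilon> r N = (exp r * r powr (N + 1) / (\<epsilon> * fact_Suc_real N)) powr (1 / N)"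

definition N_tilde :: "nat \<Rightarrow> real \<Rightarrow> real \<Rightarrow> real" where
  "N_tilde d \<epsilon> r = sqrt (lam \<epsilon> r / ln (real d))"

definition m_tilde :: "nat \<Rightarrow> real \<Rightarrow> real \<Rightarrow> real" where
  "m_tilde d \<epsilon> r = m_star \<epsilon> r (N_tilde d \<epsilon> r)"

definition m_circ :: "real \<Rightarrow> real \<Rightarrow> real" where
  "m_circ \<epsilon> r = r ^ 2 * exp r / (2 * \<epsilon>)"

definition f_bound :: "nat \<Rightarrow> real \<Rightarrow> real \<Rightarrow> real" where
  "f_bound d \<epsilon> r =
     r * real d * ln (real d) / ((real d - 1) * lam \<epsilon> r)
       * exp (1 + 2 * sqrt (lam \<epsilon> r * ln (real d)))"

end

theory Submission
  imports Defs "HOL-Real_Asymp.Real_Asymp"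
begin

text \<open>
  Write \<open>\<lambda> = lam \<epsilon> r\<close> and \<open>L = ln d\<close>. Since \<open>exp r * r powr (N + 1) / \<epsilon> = exp \<lambda> * r powr N\<close>, one
  has \<open>m_star \<epsilon> r N = r * exp (\<lambda> / N) / Gamma (N + 2) powr (1 / N)\<close>, and the choice
  \<open>N = sqrt (\<lambda> / L)\<close> balances the two exponential factors of \<open>f_d\<close>: both \<open>exp (\<lambda> / N)\<close> and \<open>d powr N\<close>
  equal \<open>exp (sqrt (\<lambda> * L))\<close>. The claimed bound then amounts to the Stirling-type inequality
  \<open>(N / exp 1) powr N \<le> Gamma (N + 2)\<close>, which follows from restricting Euler's integral
  for \<open>Gamma (N + 1)\<close> to \<open>[N, \<infinity>)\<close>, where \<open>t powr N \<ge> N powr N\<close> (lemma \<open>Gamma_plus1_ge_powr\<close>).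

  For the asymptotics, \<open>m_circ \<epsilon> r = r * exp \<lambda> / 2\<close>, so the quotient of \<open>f_bound d \<epsilon> r\<close> by
  \<open>f_d d 1 (m_circ \<epsilon> r)\<close> is a constant multiple of \<open>exp (2 * sqrt (\<lambda> * L) - \<lambda>) / \<lambda>\<close>. It depends on
  \<open>\<epsilon>\<close> and \<open>r\<close> through \<open>\<lambda>\<close> only and vanishes as \<open>\<lambda> \<rightarrow> \<infinity>\<close>, which happens in both limits.
\<close>

lemma Gamma_plus1_ge_powr:
  fixes x :: real
  assumes "x > 0"
  shows "x powr x * exp (- x) \<le> Gamma (x + 1)"
proof -
  have "((\<lambda>t. exp (- 1 * t)) has_integral exp (- 1 * x) / 1) {x..}"
    by (rule has_integral_exp_minus_to_infinity) simp
  then have "((\<lambda>t. x powr x * exp (- t)) has_integral x powr x * exp (- x)) {x..}"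
    using has_integral_mult_right[of "\<lambda>t. exp (- t)" "exp (- x)" "{x..}" "x powr x"] by simp
  then have tail: "((\<lambda>t. if t \<in> {x..} then x powr x * exp (- t) else 0)
      has_integral x powr x * exp (- x)) {0..}"
    using assms by (subst has_integral_restrict) auto
  have Euler: "((\<lambda>t. t powr x / exp t) has_integral Gamma (x + 1)) {0..}"
    using Gamma_integral_real[of "x + 1"] assms by simp
  show ?thesis
  proof (rule has_integral_le[OF tail Euler])
    fix t :: real
    show "(if t \<in> {x..} then x powr x * exp (- t) else 0) \<le> t powr x / exp t"
      using assms by (auto simp: exp_minus field_simps intro!: powr_mono2)
  qed
qed

lemma Gamma_plus2_powr_ge:
  fixes x :: real
  assumes "x > 0"
  shows "x / exp 1 \<le> Gamma (x + 2) powr (1 / x)"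
proof -
  have "(x / exp 1) powr x = x powr x * exp (- x)"
    using assms by (simp add: powr_divide exp_minus field_simps exp_powr_real)
  also have "\<dots> \<le> Gamma (x + 1)"
    using assms by (rule Gamma_plus1_ge_powr)
  also have "\<dots> \<le> (x + 1) * Gamma (x + 1)"
    using assms Gamma_real_pos[of "x + 1"] by simp
  also have "\<dots> = Gamma (x + 2)"
    using assms Gamma_plus1[of "x + 1"] by (simp add: add.commute nonpos_Ints_def add.assoc)
  finally have "((x / exp 1) powr x) powr (1 / x) \<le> Gamma (x + 2) powr (1 / x)"
    using assms by (intro powr_mono2) auto
  then show ?thesis
    using assms by (simp add: powr_powr)
qed

lemma exp_lam: "exp (lam \<epsilon> r) = r * exp r / \<epsilon>" if "\<epsilon> > 0" "r > 0"
  using that by (simp add: lam_def)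

lemma m_star_eq:
  assumes "\<epsilon> > 0" "r > 0" "N > 0"
  shows "m_star \<epsilon> r N = r * exp (lam \<epsilon> r / N) / Gamma (N + 2) powr (1 / N)"
proof -
  have G: "Gamma (N + 2) > 0"
    using assms by simp
  have "exp r * r powr (N + 1) / \<epsilon> = exp (lam \<epsilon> r) * r powr N"
    using assms by (simp add: exp_lam powr_add)
  then have "m_star \<epsilon> r N = (exp (lam \<epsilon> r) * r powr N / Gamma (N + 2)) powr (1 / N)"
    by (simp add: m_star_def fact_Suc_real_def flip: divide_divide_eq_left)
  also have "\<dots> = r * exp (lam \<epsilon> r / N) / Gamma (N + 2) powr (1 / N)"
    using assms G by (simp add: powr_divide powr_mult powr_powr exp_powr_real)
  finally show ?thesis .
qed

lemma f_d_tilde_le_f_bound: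
  assumes "d \<ge> 2" "\<epsilon> > 0" "r > 0" "lam \<epsilon> r > 0"
  shows "f_d d (N_tilde d \<epsilon> r) (m_tilde d \<epsilon> r) \<le> f_bound d \<epsilon> r"
proof -
  define l where "l = lam \<epsilon> r"
  define L where "L = ln (real d)"
  define N where "N = sqrt (l / L)"
  define s where "s = sqrt (l * L)"
  define g where "g = Gamma (N + 2) powr (1 / N)"
  have pos: "l > 0" "L > 0" "real d > 1"
    using assms by (auto simp: l_def L_def)
  have N: "N > 0" "N\<^sup>2 = l / L"
    using pos by (auto simp: N_def)
  have "N * L = s" "l / N = s"
    using pos by (simp_all add: N_def s_def real_sqrt_divide real_sqrt_mult field_simps)
  then have dN: "real d powr N = exp s" and lN: "exp (l / N) = exp s"
    using pos by (auto simp: powr_def L_def)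
  have "N / exp 1 \<le> g"
    using N Gamma_plus2_powr_ge[of N] by (simp add: g_def)
  moreover from this have "g > 0"
    using N by (intro less_le_trans[of 0 "N / exp 1" g]) auto
  ultimately have g: "g > 0" "N / exp 1 \<le> g"
    by auto
  have "f_d d (N_tilde d \<epsilon> r) (m_tilde d \<epsilon> r) = f_d d N (m_star \<epsilon> r N)"
    by (simp add: N_tilde_def m_tilde_def N_def l_def L_def)
  also have "\<dots> = r * exp s / g * (exp s * real d / ((real d - 1) * N))"
    using assms N pos lN dN by (simp add: f_d_def m_star_eq g_def powr_add flip: l_def)
  also have "\<dots> = r * real d * exp s ^ 2 / ((real d - 1) * N) * (1 / g)"
    by (simp add: power2_eq_square mult_ac)
  also have "\<dots> \<le> r * real d * exp s ^ 2 / ((real d - 1) * N) * (exp 1 / N)"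
    using g N pos assms by (intro mult_left_mono) (auto simp: field_simps)
  also have "\<dots> = r * real d / ((real d - 1) * N\<^sup>2) * (exp 1 * exp s ^ 2)"
    by (simp add: power2_eq_square mult_ac)
  also have "exp 1 * exp s ^ 2 = exp (1 + 2 * s)"
    by (simp add: exp_add exp_double)
  also have "r * real d / ((real d - 1) * N\<^sup>2) = r * real d * L / ((real d - 1) * l)"
    using pos N by simp
  also have "r * real d * L / ((real d - 1) * l) * exp (1 + 2 * s) = f_bound d \<epsilon> r"
    by (simp add: f_bound_def l_def L_def s_def)
  finally show ?thesis .
qed

lemma f_bound_eq:
  assumes "d \<ge> 2" "\<epsilon> > 0" "r > 0"
  shows "f_bound d \<epsilon> r = 2 * ln (real d) / real d *
           (exp (1 + 2 * sqrt (lam \<epsilon> r * ln (real d)) - lam \<epsilon> r) / lam \<epsilon> r) *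
           f_d d 1 (m_circ \<epsilon> r)"
proof -
  have m: "m_circ \<epsilon> r = r * exp (lam \<epsilon> r) / 2"
    using assms by (simp add: m_circ_def exp_lam power2_eq_square)
  have "f_d d 1 (m_circ \<epsilon> r) = r * exp (lam \<epsilon> r) * (real d * real d) / (2 * (real d - 1))"
    using assms by (simp add: f_d_def m power2_eq_square)
  then show ?thesis
    using assms by (simp add: f_bound_def exp_diff mult_ac del: right_diff_distrib_numeral)
qed

text \<open>The two limits of the theorem are instances of this lemma for families \<open>\<epsilon>\<close>, \<open>r\<close> along a
  filter; all that matters is that \<open>lam\<close> tends to infinity.\<close>

lemma f_bound_smallo:
  fixes \<epsilon> r :: "'a \<Rightarrow> real"
  assumes "d \<ge> 2" and pos: "eventually (\<lambda>x. \<epsilon> x > 0 \<and> r x > 0) F"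
    and lim: "filterlim (\<lambda>x. lam (\<epsilon> x) (r x)) at_top F"
  shows "(\<lambda>x. f_bound d (\<epsilon> x) (r x)) \<in> o[F](\<lambda>x. f_d d 1 (m_circ (\<epsilon> x) (r x)))"
proof -
  define L where "L = ln (real d)"
  define h where "h l = 2 * L / real d * (exp (1 + 2 * sqrt (l * L) - l) / l)" for l
  have "L > 0"
    using assms by (simp add: L_def)
  then have "((\<lambda>l. exp (1 + 2 * sqrt (l * L) - l) / l) \<longlongrightarrow> 0) at_top"
    by real_asymp
  then have "(h \<longlongrightarrow> 0) at_top"
    unfolding h_def by (rule tendsto_mult_right_zero)
  from filterlim_compose[OF this lim]
  have "(\<lambda>x. h (lam (\<epsilon> x) (r x))) \<in> o[F](\<lambda>_. 1)"
    by (intro smalloI_tendsto) auto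
  then have "(\<lambda>x. h (lam (\<epsilon> x) (r x)) * f_d d 1 (m_circ (\<epsilon> x) (r x)))
      \<in> o[F](\<lambda>x. 1 * f_d d 1 (m_circ (\<epsilon> x) (r x)))"
    by (intro landau_o.small_big_mult) auto
  moreover have "eventually (\<lambda>x. f_bound d (\<epsilon> x) (r x) =
      h (lam (\<epsilon> x) (r x)) * f_d d 1 (m_circ (\<epsilon> x) (r x))) F"
    using pos by eventually_elim (use assms f_bound_eq in \<open>simp add: h_def L_def\<close>)
  ultimately show ?thesis
    by (simp add: landau_o.small.in_cong)
qed

theorem proposition1p6:
  fixes d :: nat
  assumes "d \<ge> 2"
  shows "(\<forall>\<epsilon> r :: real. \<epsilon> > 0 \<longrightarrow> r > 0 \<longrightarrow> lam \<epsilon> r > 0 \<longrightarrow>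
            f_d d (N_tilde d \<epsilon> r) (m_tilde d \<epsilon> r) \<le> f_bound d \<epsilon> r)
       \<and> (\<forall>\<epsilon> :: real. \<epsilon> > 0 \<longrightarrow>
            (\<lambda>r. f_bound d \<epsilon> r) \<in> o[at_top](\<lambda>r. f_d d 1 (m_circ \<epsilon> r)))
       \<and> (\<forall>r :: real. r > 0 \<longrightarrow>
            (\<lambda>\<epsilon>. f_bound d \<epsilon> r) \<in> o[at_right 0](\<lambda>\<epsilon>. f_d d 1 (m_circ \<epsilon> r)))"
proof (intro conjI allI impI)
  fix \<epsilon> r :: real
  assume "\<epsilon> > 0" "r > 0" "lam \<epsilon> r > 0"
  with assms show "f_d d (N_tilde d \<epsilon> r) (m_tilde d \<epsilon> r) \<le> f_bound d \<epsilon> r"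
    by (rule f_d_tilde_le_f_bound)
next
  fix \<epsilon> :: real
  assume "\<epsilon> > 0"
  then have "filterlim (\<lambda>r. lam \<epsilon> r) at_top at_top"
    unfolding lam_def by real_asymp
  moreover have "eventually (\<lambda>r::real. \<epsilon> > 0 \<and> r > 0) at_top"
    using \<open>\<epsilon> > 0\<close> eventually_gt_at_top[of 0] by simp
  ultimately show "(\<lambda>r. f_bound d \<epsilon> r) \<in> o[at_top](\<lambda>r. f_d d 1 (m_circ \<epsilon> r))"
    using assms by (intro f_bound_smallo)
next
  fix r :: real
  assume "r > 0"
  then have "filterlim (\<lambda>\<epsilon>. lam \<epsilon> r) at_top (at_right 0)"
    unfolding lam_def by real_asymp
  moreover have "eventually (\<lambda>\<epsilon>::real. \<epsilon> > 0 \<and> r > 0) (at_right 0)"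
    using \<open>r > 0\<close> by (simp add: eventually_at_right_less)
  ultimately show "(\<lambda>\<epsilon>. f_bound d \<epsilon> r) \<in> o[at_right 0](\<lambda>\<epsilon>. f_d d 1 (m_circ \<epsilon> r))"
    using assms by (intro f_bound_smallo)
qed

end
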